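(* Let $d$ be a positive integer, $n$ an odd positive integer, and $x,y$ indeterminates. Then $$\sum_{k=0}^{n-1}\frac{(x;q^d)_k\,(y;q^d)_k}{(xyq^d;q^{2d})_k}\,q^{dk}\equiv \sum_{k=0}^{n-1}\frac{(x;q^{2d})_k\,(y;q^{2d})_k}{(xyq^{d};q^{2d})_k}\,q^{2dk} \pmod{\Phi_n(q)}.$$
   Context: The $q$-shifted factorial is $(a;q)_0=1$ and $(a;q)_k=(1-a)(1-aq)\cdots(1-aq^{k-1})$ for $k\geq 1$. $\Phi_n(q)$ denotes the $n$th cyclotomic polynomial. A congruence $A\equiv B \pmod{P(q)}$ between rational functions in $q$ (with coefficients that may involve other indeterminates such as $x,y$) means that $A-B$ can be written as a quotient whose numerator is divisible by $P(q)$ and whose denominator is coprime to $P(q)$. *)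

theory Defs
  imports
    Complex_Main
    "HOL-Computational_Algebra.Polynomial"
    "HOL-Computational_Algebra.Fraction_Field"
begin

definition qpoch :: "'a :: comm_ring_1 \<Rightarrow> 'a \<Rightarrow> nat \<Rightarrow> 'a" where
  "qpoch a q k = (\<Prod>i<k. 1 - a * q ^ i)"


definition primitive_roots_unity :: "nat \<Rightarrow> complex set" where
  "primitive_roots_unity n = {z. z ^ n = 1 \<and> (\<forall>m\<in>{1..<n}. z ^ m \<noteq> 1)}"

text \<open>
  The complex product of the factors \<open>q - z\<close> over all primitive \<open>n\<close>-th roots of unity \<open>z\<close>
  has integer coefficients; existence and uniqueness of the integer polynomial chosen here
  are proved in \<open>of_int_poly_cyclotomic_poly\<close> below.
\<close>
definition cyclotomic_poly :: "nat \<Rightarrow> int poly" where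
  "cyclotomic_poly n =
     (THE p. map_poly of_int p = (\<Prod>z\<in>primitive_roots_unity n. [:- z, 1:]))"

lemma finite_primitive_roots_unity: "n > 0 \<Longrightarrow> finite (primitive_roots_unity n)"
  using finite_roots_unity[of n, where ?'a = complex]
  by (rule finite_subset[rotated]) (auto simp: primitive_roots_unity_def)

lemma ex_primitive_root_unity_order:
  fixes z :: complex
  assumes "n > 0" "z ^ n = 1"
  shows "\<exists>m. m dvd n \<and> m > 0 \<and> z \<in> primitive_roots_unity m"
proof -
  define m where "m = (LEAST m. m > 0 \<and> z ^ m = 1)"
  have m: "m > 0" "z ^ m = 1"
    using LeastI[of "\<lambda>m. m > 0 \<and> z ^ m = 1" n] assms by (auto simp: m_def)
  have least: "m \<le> k" if "k > 0" "z ^ k = 1" for k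
    unfolding m_def by (rule Least_le) (use that in auto)
  have "z ^ n = z ^ (m * (n div m) + n mod m)"
    by simp
  also have "\<dots> = z ^ (n mod m)"
    using m by (simp only: power_add power_mult) simp
  finally have "z ^ (n mod m) = 1"
    using assms by simp
  moreover have "n mod m < m"
    using m by simp
  ultimately have "n mod m = 0"
    using least[of "n mod m"] by (cases "n mod m = 0") auto
  moreover have "z \<in> primitive_roots_unity m"
    unfolding primitive_roots_unity_def
  proof (intro CollectI conjI ballI notI)
    fix k assume "k \<in> {1..<m}" "z ^ k = 1"
    with least[of k] show False
      by simp
  qed (fact m)
  ultimately show ?thesis
    using m by (intro exI[of _ m]) auto
qed

lemma prod_primitive_roots_unity:
  assumes "n > 0"
  shows "(\<Prod>m | m dvd n. \<Prod>z\<in>primitive_roots_unity m. [:- z, 1:]) = monom 1 n - 1"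
proof -
  have pos: "m > 0" if "m dvd n" for m
    using that assms by (auto intro!: Nat.gr0I)
  have U: "(\<Union>m\<in>{m. m dvd n}. primitive_roots_unity m) = {z. z ^ n = 1}"
  proof (intro equalityI subsetI)
    fix z assume "z \<in> (\<Union>m\<in>{m. m dvd n}. primitive_roots_unity m)"
    thus "z \<in> {z. z ^ n = 1}"
      by (auto simp: primitive_roots_unity_def power_mult elim!: dvdE)
  next
    fix z :: complex assume "z \<in> {z. z ^ n = 1}"
    thus "z \<in> (\<Union>m\<in>{m. m dvd n}. primitive_roots_unity m)"
      using ex_primitive_root_unity_order[OF assms] by blast
  qed
  have disj: "primitive_roots_unity i \<inter> primitive_roots_unity j = {}"
    if "i dvd n" "j dvd n" "i \<noteq> j" for i j
    using pos[OF that(1)] pos[OF that(2)] that(3)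
    by (cases i j rule: linorder_cases) (auto simp: primitive_roots_unity_def)
  have "(\<Prod>m | m dvd n. \<Prod>z\<in>primitive_roots_unity m. [:- z, 1:]) =
        (\<Prod>z\<in>(\<Union>m\<in>{m. m dvd n}. primitive_roots_unity m). [:- z, 1:])"
    using assms pos disj
    by (intro prod.UNION_disjoint [symmetric] ballI finite_primitive_roots_unity) auto
  also have "\<dots> = (\<Prod>z | z ^ n = 1. [:- z, 1:])"
    by (simp only: U)
  also have "\<dots> = monom 1 n - 1"
  proof (rule poly_eqI_degree_lead_coeff[where n = n and A = "{z::complex. z ^ n = 1}"])
    have "degree (\<Prod>z | z ^ n = 1. [:- z, 1:] :: complex poly) = n"
      by (subst degree_prod_sum_eq) (use assms card_roots_unity_eq in auto)
    moreover have "lead_coeff (\<Prod>z | z ^ n = 1. [:- z, 1:] :: complex poly) = 1"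
      by (simp add: lead_coeff_prod)
    ultimately show "coeff (\<Prod>z | z ^ n = 1. [:- z, 1:]) n = coeff (monom 1 n - 1 :: complex poly) n"
      "degree (\<Prod>z | z ^ n = 1. [:- z, 1:] :: complex poly) \<le> n"
      using assms by (auto simp: coeff_1)
    show "degree (monom 1 n - 1 :: complex poly) \<le> n"
      by (intro degree_diff_le) (auto simp: degree_monom_le)
    show "n \<le> card {z::complex. z ^ n = 1}"
      using assms by (simp add: card_roots_unity_eq)
    show "poly (\<Prod>z | z ^ n = 1. [:- z, 1:]) z = poly (monom 1 n - 1) z"
      if "z \<in> {z. z ^ n = 1}" for z :: complex
      using that assms finite_roots_unity[of n, where ?'a = complex]
      by (auto simp: poly_prod poly_monom prod_zero_iff)
  qed
  finally show ?thesis .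
qed

lemma map_poly_of_int_mult:
  "map_poly of_int (p * q) = map_poly of_int p * (map_poly of_int q :: 'a :: comm_ring_1 poly)"
  by (intro poly_eqI) (simp add: coeff_map_poly coeff_mult)

lemma map_poly_of_int_prod:
  "map_poly of_int (\<Prod>x\<in>A. f x) = (\<Prod>x\<in>A. map_poly of_int (f x) :: 'a :: comm_ring_1 poly)"
  by (induction A rule: infinite_finite_induct) (simp_all add: map_poly_of_int_mult)

lemma ex_int_cyclotomic_poly:
  "\<exists>p. map_poly of_int p = (\<Prod>z\<in>primitive_roots_unity n. [:- z, 1:])"
proof (induction n rule: less_induct)
  case (less n)
  define \<Psi> where "\<Psi> = (\<lambda>m. \<Prod>z\<in>primitive_roots_unity m. [:- z, 1:])"
  show ?case
  proof (cases "n = 0")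
    case True
    have "primitive_roots_unity 0 = UNIV"
      by (auto simp: primitive_roots_unity_def)
    thus ?thesis
      using True by (intro exI[of _ 1]) (simp add: infinite_UNIV_char_0)
  next
    case False
    from less obtain f where f: "map_poly of_int (f m) = \<Psi> m" if "m < n" for m
      unfolding \<Psi>_def by metis
    define S where "S = {m. m dvd n \<and> m \<noteq> n}"
    have S: "m < n" if "m \<in> S" for m
      using that False by (auto simp: S_def dest: dvd_imp_le)
    have "finite {m. m dvd n}"
      using False by simp
    moreover have "{m. m dvd n} = insert n S"
      by (auto simp: S_def)
    ultimately have "finite S"
      by simp
    define A where "A = (\<Prod>m\<in>S. f m)"
    have A: "map_poly of_int A = (\<Prod>m\<in>S. \<Psi> m)"
      unfolding A_def map_poly_of_int_prod by (intro prod.cong refl f S)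
    have "\<Psi> n * (\<Prod>m\<in>S. \<Psi> m) = (\<Prod>m\<in>insert n S. \<Psi> m)"
      using \<open>finite S\<close> by (subst prod.insert) (auto simp: S_def)
    hence eq: "\<Psi> n * (\<Prod>m\<in>S. \<Psi> m) = monom 1 n - 1"
      using prod_primitive_roots_unity[of n] False \<open>{m. m dvd n} = insert n S\<close>
      by (simp add: \<Psi>_def)
    have "lead_coeff (map_poly of_int A :: complex poly) = 1"
      unfolding A by (simp add: \<Psi>_def lead_coeff_prod)
    hence lc: "lead_coeff A = 1"
      by (simp add: coeff_map_poly degree_map_poly)
    hence "A \<noteq> 0"
      by auto
    obtain Q R where QR: "pseudo_divmod (monom 1 n - 1) A = (Q, R)"
      by force
    from pseudo_divmod[OF \<open>A \<noteq> 0\<close> QR] lc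
    have 1: "monom 1 n - 1 = A * Q + R" and 2: "R = 0 \<or> degree R < degree A"
      by auto
    have "map_poly of_int (monom 1 n - 1 :: int poly) = (monom 1 n - 1 :: complex poly)"
      by (intro poly_eqI) (simp add: coeff_map_poly coeff_1)
    moreover have "map_poly of_int (A * Q + R) =
      (map_poly of_int A * map_poly of_int Q + map_poly of_int R :: complex poly)"
      by (subst map_poly_of_int_mult [symmetric], intro poly_eqI) (simp add: coeff_map_poly)
    ultimately have "map_poly of_int A * \<Psi> n =
       map_poly of_int A * map_poly of_int Q + map_poly of_int R"
      using 1 eq A by (simp add: mult.commute)
    hence R: "map_poly of_int R = map_poly of_int A * (\<Psi> n - map_poly of_int Q)"
      by (simp add: algebra_simps)
    have "\<Psi> n - map_poly of_int Q = 0"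
    proof (rule ccontr)
      assume *: "\<Psi> n - map_poly of_int Q \<noteq> 0"
      have "(map_poly of_int A :: complex poly) \<noteq> 0"
        using \<open>lead_coeff (map_poly of_int A :: complex poly) = 1\<close> by auto
      with * R have "degree (map_poly of_int R :: complex poly) \<ge> degree (map_poly of_int A :: complex poly)"
        and "(map_poly of_int R :: complex poly) \<noteq> 0"
        by (auto simp: degree_mult_eq)
      hence "degree R \<ge> degree A" "R \<noteq> 0"
        by (auto simp: degree_map_poly)
      with 2 show False
        by simp
    qed
    thus ?thesis
      by (intro exI[of _ Q]) (simp add: \<Psi>_def)
  qed
qed

lemma of_int_poly_cyclotomic_poly:
  "map_poly of_int (cyclotomic_poly n) = (\<Prod>z\<in>primitive_roots_unity n. [:- z, 1:])"
  unfolding cyclotomic_poly_def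
proof (rule theI')
  show "\<exists>!p. map_poly of_int p = (\<Prod>z\<in>primitive_roots_unity n. [:- z, 1:])"
  proof (rule ex_ex1I[OF ex_int_cyclotomic_poly])
    fix p p' :: "int poly"
    assume "map_poly of_int p = (\<Prod>z\<in>primitive_roots_unity n. [:- z, 1:])"
      and "map_poly of_int p' = (\<Prod>z\<in>primitive_roots_unity n. [:- z, 1:])"
    hence "coeff (map_poly complex_of_int p) i = coeff (map_poly complex_of_int p') i" for i
      by simp
    thus "p = p'"
      by (intro poly_eqI) (simp add: coeff_map_poly)
  qed
qed


text \<open>
  Rational functions in \<open>q\<close> with coefficients in \<open>'a\<close> are the fractions of polynomials
  over \<open>'a\<close>; divisibility and coprimality are those of the ring \<open>'a poly\<close>.
\<close>
definition ratfun_cong ::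
    "'a :: idom_divide poly fract \<Rightarrow> 'a poly fract \<Rightarrow> 'a poly \<Rightarrow> bool" where
  "ratfun_cong A B P \<longleftrightarrow>
     (\<exists>N D. D \<noteq> 0 \<and> A - B = Fract N D \<and> P dvd N \<and> coprime D P)"


text \<open>
  The indeterminates as elements of the fraction field of \<open>\<int>[x][y][q]\<close>, that is, of \<open>\<rat>(x, y, q)\<close>;
  the outermost polynomial variable is \<open>q\<close>.
\<close>
definition var_q :: "int poly poly poly fract" where
  "var_q = Fract [:0, 1:] 1"

definition var_y :: "int poly poly poly fract" where
  "var_y = Fract [:[:0, 1:]:] 1"

definition var_x :: "int poly poly poly fract" where
  "var_x = Fract [:[:[:0, 1:]:]:] 1"

end

theory Submission
  imports Defs "Subresultants.More_Homomorphisms" "HOL-Number_Theory.Cong"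
begin

text \<open>
  Write \<open>S_b(x)\<close> for the sum whose numerators have base \<open>b\<close>, where \<open>b\<close> is \<open>Q\<close> or \<open>Q\<^sup>2\<close> and
  \<open>Q = q ^ d\<close>, and put \<open>w = x y Q\<close>. Both sums satisfy
  \<open>y (1 - x) (1 - Q x) S_b(x Q\<^sup>2) + x (1 - w) S_b(x) = (1 - w) (1 - V_b)\<close> with
  \<open>V_b = (x; b)_n (y; b)_n / (w; Q\<^sup>2)_n\<close>. When \<open>q\<close> is an \<open>n\<close>-th root of unity and \<open>n\<close> is odd,
  squaring permutes the powers of \<open>Q\<close>, so that \<open>V_b\<close> does not depend on \<open>b\<close> and the
  difference of the two sums satisfies the homogeneous recurrence. For \<open>|x|\<close> small this makes
  the difference shrink under \<open>x \<mapsto> x Q\<^sup>2\<close>; as \<open>n\<close> such steps lead back to \<open>x\<close>, it vanishes.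
  The numerator of the difference, an element of \<open>\<int>[x, y][q]\<close>, therefore vanishes at all primitive
  \<open>n\<close>-th roots of unity, and division by the monic \<open>\<Phi>_n\<close> shows that \<open>\<Phi>_n\<close> divides it.
\<close>

section \<open>q-shifted factorials and the squaring of their base\<close>

lemma qpoch_0 [simp]: "qpoch a q 0 = 1"
  by (simp add: qpoch_def)

lemma qpoch_Suc: "qpoch a q (Suc k) = qpoch a q k * (1 - a * q ^ k)"
  by (simp add: qpoch_def)

text \<open>Both sides are \<open>qpoch a q (Suc k)\<close>, with its first or its last factor split
  off.\<close>

lemma qpoch_shift: "(1 - a) * qpoch (a * q) q k = qpoch a q k * (1 - a * q ^ k)"
proof (induction k)
  case (Suc k)
  have "(1 - a) * qpoch (a * q) q (Suc k) = (1 - a) * qpoch (a * q) q k * (1 - a * q * q ^ k)"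
    by (simp add: qpoch_Suc mult.assoc)
  also have "\<dots> = qpoch a q (Suc k) * (1 - a * q ^ Suc k)"
    by (simp add: Suc.IH qpoch_Suc mult_ac)
  finally show ?case .
qed simp

lemma qpoch_eq_0_iff:
  fixes a :: "'a :: idom"
  shows "qpoch a q k = 0 \<longleftrightarrow> (\<exists>i<k. a * q ^ i = 1)"
  by (auto simp: qpoch_def)

text \<open>Powers of \<open>Q\<close> depend only on the exponent modulo \<open>n\<close>, and
  doubling permutes the residues because \<open>2\<close> is invertible modulo the odd
  \<open>n\<close>.\<close>

lemma qpoch_square_base:
  fixes Q :: "'a :: comm_ring_1"
  assumes "Q ^ n = 1" "odd n"
  shows "qpoch x (Q\<^sup>2) n = qpoch x Q n"
proof -
  have Q_mod: "Q ^ (k mod n) = Q ^ k" for k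
  proof -
    have "Q ^ k = Q ^ (n * (k div n) + k mod n)"
      by simp
    also have "\<dots> = Q ^ (k mod n)"
      using assms(1) by (simp only: power_add power_mult) simp
    finally show ?thesis ..
  qed
  have "inj_on (\<lambda>i. 2 * i mod n) {..<n}"
  proof (rule inj_onI)
    fix i j assume ij: "i \<in> {..<n}" "j \<in> {..<n}" "2 * i mod n = 2 * j mod n"
    have "coprime 2 n"
      using assms(2) by simp
    hence "[i = j] (mod n)"
      using ij(3) cong_mult_lcancel_nat[of 2 n i j] by (simp add: cong_def)
    thus "i = j"
      using ij by (simp add: cong_def)
  qed
  moreover have "(\<lambda>i. 2 * i mod n) ` {..<n} \<subseteq> {..<n}"
    using assms(2) by (auto intro!: mod_less_divisor Nat.gr0I)
  ultimately have "bij_betw (\<lambda>i. 2 * i mod n) {..<n} {..<n}"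
    by (simp add: bij_betw_def endo_inj_surj)
  hence "(\<Prod>i<n. 1 - x * Q ^ (2 * i mod n)) = (\<Prod>i<n. 1 - x * Q ^ i)"
    by (rule prod.reindex_bij_betw)
  thus ?thesis
    by (simp add: qpoch_def Q_mod power_mult)
qed

section \<open>The two sums and their recurrence in \<open>x\<close>\<close>

definition qsum :: "'a :: field \<Rightarrow> 'a \<Rightarrow> 'a \<Rightarrow> 'a \<Rightarrow> nat \<Rightarrow> 'a" where
  "qsum b Q x y n = (\<Sum>k<n. qpoch x b k * qpoch y b k / qpoch (x * y * Q) (Q\<^sup>2) k * b ^ k)"

text \<open>Telescoping: the \<open>k\<close>-th terms on the left combine to
  \<open>(1 - w) * (V k - V (Suc k))\<close>. The coefficients on the left do not depend on
  \<open>b\<close>, so the recurrences for the two bases can be subtracted.\<close>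

lemma qsum_recurrence:
  fixes Q :: "'a :: field"
  assumes b: "b = Q \<or> b = Q\<^sup>2"
    and nz: "\<And>i. x * y * Q * (Q\<^sup>2) ^ i \<noteq> 1"
  shows "y * (1 - x) * (1 - Q * x) * qsum b Q (x * Q\<^sup>2) y n + x * (1 - x * y * Q) * qsum b Q x y n =
           (1 - x * y * Q) * (1 - qpoch x b n * qpoch y b n / qpoch (x * y * Q) (Q\<^sup>2) n)"
proof -
  define w where "w = x * y * Q"
  have w: "x * Q\<^sup>2 * y * Q = w * Q\<^sup>2"
    by (simp add: w_def algebra_simps)
  have w1: "1 - w \<noteq> 0"
    using nz[of 0] by (simp add: w_def)
  have wk: "1 - w * (Q\<^sup>2) ^ k \<noteq> 0" for k
    using nz[of k] by (simp add: w_def)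
  have W: "qpoch w (Q\<^sup>2) k \<noteq> 0" for k
    using nz by (simp add: w_def qpoch_eq_0_iff)
  have W': "qpoch (w * Q\<^sup>2) (Q\<^sup>2) k = qpoch w (Q\<^sup>2) k * (1 - w * (Q\<^sup>2) ^ k) / (1 - w)" for k
    using qpoch_shift[of w "Q\<^sup>2" k] w1 by (simp add: field_simps)
  define V where "V = (\<lambda>k. qpoch x b k * qpoch y b k / qpoch w (Q\<^sup>2) k)"
  have V_Suc: "V (Suc k) = V k * ((1 - x * b ^ k) * (1 - y * b ^ k) / (1 - w * (Q\<^sup>2) ^ k))" for k
    by (simp add: V_def qpoch_Suc)
  \<comment> \<open>\<open>c k\<close> accounts for replacing \<open>x\<close> by
    \<open>x * Q\<^sup>2\<close> in the numerator: two applications of \<open>qpoch_shift\<close> if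
    \<open>b = Q\<close>, one if \<open>b = Q\<^sup>2\<close>, where the factor
    \<open>1 - Q * x\<close> is carried along.\<close>
  define c where "c = (\<lambda>k. if b = Q then (1 - x * Q ^ k) * (1 - x * Q * Q ^ k)
                              else (1 - x * (Q\<^sup>2) ^ k) * (1 - Q * x))"
  have c: "(1 - x) * (1 - Q * x) * qpoch (x * Q\<^sup>2) b k = qpoch x b k * c k" for k
  proof (cases "b = Q")
    case True
    have "(1 - x) * (1 - Q * x) * qpoch (x * Q\<^sup>2) b k =
            (1 - x) * ((1 - x * Q) * qpoch (x * Q * Q) Q k)"
      by (simp add: True power2_eq_square mult_ac)
    also have "\<dots> = (1 - x) * qpoch (x * Q) Q k * (1 - x * Q * Q ^ k)"
      by (simp add: qpoch_shift)
    also have "\<dots> = qpoch x b k * c k"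
      by (simp add: qpoch_shift c_def True)
    finally show ?thesis .
  next
    case False
    hence "b = Q\<^sup>2"
      using b by blast
    have "(1 - x) * (1 - Q * x) * qpoch (x * Q\<^sup>2) b k =
            (1 - Q * x) * ((1 - x) * qpoch (x * b) b k)"
      by (simp add: \<open>b = Q\<^sup>2\<close> mult_ac)
    also have "\<dots> = qpoch x b k * c k"
      using False by (simp add: qpoch_shift c_def \<open>b = Q\<^sup>2\<close> mult_ac)
    finally show ?thesis .
  qed
  \<comment> \<open>The identity behind the telescoping: divided by
    \<open>1 - w * (Q\<^sup>2) ^ k\<close>, its right-hand side is one minus the factor leading from
    \<open>V k\<close> to \<open>V (Suc k)\<close>.\<close>
  have c': "y * c k * b ^ k + x * (1 - w * (Q\<^sup>2) ^ k) * b ^ k =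
              (1 - w * (Q\<^sup>2) ^ k) - (1 - x * b ^ k) * (1 - y * b ^ k)" for k
  proof (cases "b = Q")
    case True
    have "(Q\<^sup>2) ^ k = (Q ^ k)\<^sup>2"
      by (simp flip: power_mult add: mult.commute)
    thus ?thesis
      by (simp add: True c_def w_def algebra_simps power2_eq_square)
  next
    case False
    hence "b = Q\<^sup>2"
      using b by blast
    thus ?thesis
      using False by (simp add: c_def w_def algebra_simps)
  qed
  have step: "y * (1 - x) * (1 - Q * x) *
                (qpoch (x * Q\<^sup>2) b k * qpoch y b k / qpoch (w * Q\<^sup>2) (Q\<^sup>2) k * b ^ k) +
              x * (1 - w) * (qpoch x b k * qpoch y b k / qpoch w (Q\<^sup>2) k * b ^ k) =
              (1 - w) * (V k - V (Suc k))" (is "?l = _") for k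
  proof -
    have "?l = y * ((1 - x) * (1 - Q * x) * qpoch (x * Q\<^sup>2) b k) * qpoch y b k * b ^ k
                 / qpoch (w * Q\<^sup>2) (Q\<^sup>2) k + x * (1 - w) * (V k * b ^ k)"
      by (simp add: V_def mult_ac)
    also have "\<dots> = (1 - w) * V k * (y * c k * b ^ k / (1 - w * (Q\<^sup>2) ^ k)) + x * (1 - w) * (V k * b ^ k)"
      unfolding c W' V_def using w1 W[of k] wk[of k] by (simp add: mult_ac)
    also have "\<dots> = (1 - w) * V k * ((y * c k * b ^ k + x * (1 - w * (Q\<^sup>2) ^ k) * b ^ k) / (1 - w * (Q\<^sup>2) ^ k))"
      using wk[of k] by (simp add: add_divide_distrib distrib_left mult_ac)
    also have "\<dots> = (1 - w) * (V k - V (Suc k))"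
    proof -
      have "a * v * ((e - f) / e) = a * (v - v * (f / e))" if "e \<noteq> 0" for a v e f :: 'a
        using that by (simp add: field_simps)
      from this[OF wk[of k]] show ?thesis
        unfolding c' V_Suc .
    qed
    finally show ?thesis .
  qed
  have "y * (1 - x) * (1 - Q * x) * qsum b Q (x * Q\<^sup>2) y n + x * (1 - w) * qsum b Q x y n =
          (\<Sum>k<n. (1 - w) * (V k - V (Suc k)))"
    unfolding qsum_def w w_def [symmetric] sum_distrib_left sum.distrib [symmetric] step ..
  also have "\<dots> = (1 - w) * (V 0 - V n)"
    by (simp only: sum_distrib_left [symmetric] sum_lessThan_telescope')
  finally show ?thesis
    by (simp add: V_def w_def)
qed

text \<open>The bounds keep \<open>x * y * Q\<close> in the disc of radius 1/4, so that no
  denominator vanishes, and make the recurrence a contraction: its two coefficients have moduli at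
  least 49/64 and at most 5/32, a ratio below 1/2.\<close>

lemma qsum_square_base:
  fixes Q x y :: complex
  assumes "Q ^ n = 1" "odd n" and x: "norm x \<le> 1 / 8" and y: "1 \<le> norm y" "norm y \<le> 2"
  shows "qsum Q Q x y n = qsum (Q\<^sup>2) Q x y n"
proof -
  have "n > 0"
    using assms(2) by (auto intro: Nat.gr0I)
  have Q: "norm Q = 1"
    using power_eq_1_iff[OF assms(1)] \<open>n > 0\<close> by simp
  define D where "D = (\<lambda>u. qsum Q Q u y n - qsum (Q\<^sup>2) Q u y n)"
  have step: "norm (D (u * Q\<^sup>2)) \<le> norm (D u) / 2" if u: "norm u \<le> 1 / 8" for u
  proof -
    have uy: "norm (u * y * Q) \<le> 1 / 4"
      using mult_mono[OF u y(2)] by (simp add: norm_mult Q)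
    have nz: "u * y * Q * (Q\<^sup>2) ^ i \<noteq> 1" for i
    proof
      assume "u * y * Q * (Q\<^sup>2) ^ i = 1"
      hence "norm (u * y * Q * (Q\<^sup>2) ^ i) = 1"
        by simp
      thus False
        using uy by (simp add: norm_mult norm_power Q)
    qed
    have "y * (1 - u) * (1 - Q * u) * D (u * Q\<^sup>2) + u * (1 - u * y * Q) * D u = 0"
    proof -
      have "a * (s - t) + b * (s' - t') = 0"
        if "a * s + b * s' = c" "a * t + b * t' = c" for a b c s s' t t' :: complex
        using that by (simp add: algebra_simps)
      \<comment> \<open>Folding turns the base \<open>Q\<close> products of length \<open>n\<close>
        into base \<open>Q\<^sup>2\<close>, which gives both recurrences the same right-hand side
        \<open>c\<close>.\<close>
      from this[OF qsum_recurrence[of Q Q u y n, OF disjI1[OF refl] nz,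
            folded qpoch_square_base[OF assms(1,2)]]
          qsum_recurrence[of "Q\<^sup>2" Q u y n, OF disjI2[OF refl] nz]]
      show ?thesis
        by (simp add: D_def)
    qed
    hence "y * (1 - u) * (1 - Q * u) * D (u * Q\<^sup>2) = - (u * (1 - u * y * Q) * D u)"
      by (simp add: eq_neg_iff_add_eq_0)
    from arg_cong[OF this, of norm]
    have eq: "norm y * norm (1 - u) * norm (1 - Q * u) * norm (D (u * Q\<^sup>2)) =
                 norm u * norm (1 - u * y * Q) * norm (D u)"
      by (simp only: norm_mult norm_minus_cancel)
    have "norm (1 - u) \<ge> 7 / 8" "norm (1 - Q * u) \<ge> 7 / 8"
      using norm_triangle_ineq2[of 1 u] norm_triangle_ineq2[of 1 "Q * u"] u
      by (simp_all add: norm_mult Q)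
    hence "1 * (7 / 8) * (7 / 8) \<le> norm y * norm (1 - u) * norm (1 - Q * u)"
      using y by (intro mult_mono) auto
    hence "(7 / 8) * (7 / 8) * norm (D (u * Q\<^sup>2)) \<le> norm u * norm (1 - u * y * Q) * norm (D u)"
      unfolding eq [symmetric] by (intro mult_right_mono) auto
    also have "norm (1 - u * y * Q) \<le> 5 / 4"
      using norm_triangle_ineq4[of 1 "u * y * Q"] uy by simp
    hence "norm u * norm (1 - u * y * Q) * norm (D u) \<le> (1 / 8) * (5 / 4) * norm (D u)"
      using u by (intro mult_mono) auto
    finally show ?thesis
      using norm_ge_zero[of "D (u * Q\<^sup>2)"] norm_ge_zero[of "D u"] by linarith
  qed
  have iter: "norm (D (x * (Q\<^sup>2) ^ i)) \<le> norm (D x) / 2 ^ i" for i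
  proof (induction i)
    case (Suc i)
    have "norm (x * (Q\<^sup>2) ^ i) \<le> 1 / 8"
      using x by (simp add: norm_mult norm_power Q)
    from step[OF this] Suc show ?case
      by (simp add: mult_ac)
  qed simp
  \<comment> \<open>For \<open>i = n\<close> the point in \<open>iter\<close> is \<open>x\<close>
    again, so \<open>norm (D x)\<close> is bounded by a proper fraction of itself.\<close>
  have "(Q\<^sup>2) ^ n = (Q ^ n)\<^sup>2"
    unfolding power_mult [symmetric] by (simp only: mult.commute)
  hence "(Q\<^sup>2) ^ n = 1"
    using assms(1) by simp
  with iter[of n] have "norm (D x) * 2 ^ n \<le> norm (D x) * 1"
    by (simp add: pos_le_divide_eq)
  moreover have "(2::real) ^ n > 1"
    using \<open>n > 0\<close> by simp
  ultimately have "norm (D x) = 0"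
    using norm_ge_zero[of "D x"] by (simp only: mult_le_cancel_left) linarith
  thus ?thesis
    by (simp add: D_def)
qed

text \<open>The sum multiplied by the common denominator
  \<open>qpoch (x * y * Q) (Q\<^sup>2) n\<close>. Being free of division, it makes sense for
  polynomials and commutes with ring homomorphisms.\<close>

definition qsum_num :: "'a :: comm_ring_1 \<Rightarrow> 'a \<Rightarrow> 'a \<Rightarrow> 'a \<Rightarrow> nat \<Rightarrow> 'a" where
  "qsum_num b Q x y n =
     (\<Sum>k<n. qpoch x b k * qpoch y b k * (\<Prod>i=k..<n. 1 - x * y * Q * (Q\<^sup>2) ^ i) * b ^ k)"

lemma qsum_num_eq:
  assumes "qpoch (x * y * Q) (Q\<^sup>2) n \<noteq> (0 :: 'a :: field)"
  shows "qsum_num b Q x y n = qpoch (x * y * Q) (Q\<^sup>2) n * qsum b Q x y n"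
proof -
  have "qpoch x b k * qpoch y b k * (\<Prod>i=k..<n. 1 - x * y * Q * (Q\<^sup>2) ^ i) * b ^ k =
        qpoch (x * y * Q) (Q\<^sup>2) n * (qpoch x b k * qpoch y b k / qpoch (x * y * Q) (Q\<^sup>2) k * b ^ k)"
    if "k < n" for k
  proof -
    have "{..<n} = {..<k} \<union> {k..<n}" "{..<k} \<inter> {k..<n} = {}"
      using that by auto
    hence eq: "qpoch (x * y * Q) (Q\<^sup>2) n =
             qpoch (x * y * Q) (Q\<^sup>2) k * (\<Prod>i=k..<n. 1 - x * y * Q * (Q\<^sup>2) ^ i)"
      unfolding qpoch_def by (simp add: prod.union_disjoint)
    with assms have "qpoch (x * y * Q) (Q\<^sup>2) k \<noteq> 0"
      by auto
    thus ?thesis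
      unfolding eq by (simp add: mult_ac)
  qed
  thus ?thesis
    unfolding qsum_num_def qsum_def sum_distrib_left by (intro sum.cong) auto
qed

section \<open>Ring homomorphisms and specialisation of the indeterminates\<close>

lemma (in comm_ring_hom) hom_qpoch: "hom (qpoch a q k) = qpoch (hom a) (hom q) k"
  by (simp add: qpoch_def hom_distribs)

lemma (in comm_ring_hom) hom_qsum_num:
  "hom (qsum_num b Q x y n) = qsum_num (hom b) (hom Q) (hom x) (hom y) n"
  by (simp add: qsum_num_def hom_distribs hom_qpoch)

lemma comm_ring_hom_eval_poly:
  assumes "comm_ring_hom h"
  shows "comm_ring_hom (\<lambda>p. eval_poly h p a)"
proof -
  interpret comm_ring_hom h by fact
  interpret map: map_poly_comm_ring_hom h ..
  show ?thesis
    by unfold_locales (simp_all add: eval_poly_def map.hom_add map.hom_mult)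
qed

text \<open>The outer polynomial variable is \<open>y\<close>, so the coefficients are evaluated at
  \<open>x\<close> first.\<close>

definition eval_xy :: "complex \<Rightarrow> complex \<Rightarrow> int poly poly \<Rightarrow> complex" where
  "eval_xy x y p = eval_poly (\<lambda>c. eval_poly of_int c x) p y"

lemma comm_ring_hom_eval_xy: "comm_ring_hom (eval_xy x y)"
proof -
  have "comm_ring_hom (of_int :: int \<Rightarrow> complex)"
    by unfold_locales auto
  thus ?thesis
    unfolding eval_xy_def by (intro comm_ring_hom_eval_poly)
qed

text \<open>One variable at a time: a nonzero coefficient, a polynomial in \<open>x\<close>,
  survives at some point of \<open>A\<close>; the resulting nonzero polynomial in \<open>y\<close>
  has too few roots to vanish on \<open>B\<close>.\<close>

lemma eval_xy_eq_0_imp_eq_0: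
  assumes A: "infinite A" and B: "infinite B"
    and zero: "\<And>x y. x \<in> A \<Longrightarrow> y \<in> B \<Longrightarrow> eval_xy x y p = 0"
  shows "p = 0"
proof (rule poly_eqI)
  fix i
  have "map_poly of_int (coeff p i) = (0 :: complex poly)"
  proof (rule ccontr)
    assume "map_poly of_int (coeff p i) \<noteq> (0 :: complex poly)"
    hence "finite {x. eval_poly (of_int :: int \<Rightarrow> complex) (coeff p i) x = 0}"
      unfolding eval_poly_def by (rule poly_roots_finite)
    with A obtain x where x: "x \<in> A" "eval_poly (of_int :: int \<Rightarrow> complex) (coeff p i) x \<noteq> 0"
      by (metis (mono_tags, lifting) finite_subset mem_Collect_eq subsetI)
    define r where "r = map_poly (\<lambda>c. eval_poly (of_int :: int \<Rightarrow> complex) c x) p"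
    have "coeff r i \<noteq> 0"
      using x by (simp add: r_def coeff_map_poly eval_poly_def)
    hence "r \<noteq> 0"
      by auto
    hence "finite {y. poly r y = 0}"
      by (rule poly_roots_finite)
    moreover have "B \<subseteq> {y. poly r y = 0}"
      using zero[OF x(1)] by (auto simp: eval_xy_def eval_poly_def r_def)
    ultimately show False
      using B finite_subset by blast
  qed
  thus "coeff p i = coeff 0 i"
    by (simp add: map_poly_eq_0_iff)
qed

lemma eval_xy_of_int: "eval_xy x y (of_int c) = of_int c"
proof -
  interpret comm_ring_hom "eval_xy x y" by (rule comm_ring_hom_eval_xy)
  show ?thesis by (rule hom_of_int)
qed

text \<open>Ring homomorphisms fix integer constants, so the factorisation over the primitive roots
  survives specialisation.\<close>

lemma map_poly_eval_xy_cyclotomic: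
  "map_poly (eval_xy x y) (map_poly of_int (cyclotomic_poly n)) =
     (\<Prod>z\<in>primitive_roots_unity n. [:- z, 1:])"
proof -
  interpret comm_ring_hom "eval_xy x y" by (rule comm_ring_hom_eval_xy)
  have "map_poly (eval_xy x y) (map_poly of_int (cyclotomic_poly n)) =
          map_poly of_int (cyclotomic_poly n)"
    by (simp add: map_poly_map_poly o_def eval_xy_of_int)
  thus ?thesis
    by (simp add: of_int_poly_cyclotomic_poly)
qed

section \<open>Divisibility by and coprimality to the cyclotomic polynomial\<close>

lemma lead_coeff_cyclotomic: "lead_coeff (cyclotomic_poly n) = 1"
proof -
  have "lead_coeff (map_poly of_int (cyclotomic_poly n) :: complex poly) = 1"
    by (simp add: of_int_poly_cyclotomic_poly lead_coeff_prod)
  thus ?thesis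
    by (simp add: coeff_map_poly degree_map_poly)
qed

lemma lead_coeff_map_cyclotomic:
  "lead_coeff (map_poly of_int (cyclotomic_poly n) :: 'a :: {comm_ring_1, ring_char_0} poly) = 1"
  using lead_coeff_cyclotomic[of n] by (simp add: coeff_map_poly degree_map_poly)

lemma degree_cyclotomic:
  "degree (map_poly of_int (cyclotomic_poly n) :: 'a :: {comm_ring_1, ring_char_0} poly) =
     card (primitive_roots_unity n)"
proof -
  have "degree (map_poly of_int (cyclotomic_poly n) :: 'a poly) =
        degree (map_poly of_int (cyclotomic_poly n) :: complex poly)"
    by (simp add: degree_map_poly)
  also have "\<dots> = card (primitive_roots_unity n)"
    unfolding of_int_poly_cyclotomic_poly by (subst degree_prod_sum_eq) auto
  finally show ?thesis .
qed

text \<open>The remainder of \<open>N\<close>, specialised at a point of the infinite grid, vanishes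
  at more points than its degree allows. Its coefficients thus vanish on the whole grid and are
  zero.\<close>

lemma cyclotomic_dvdI:
  fixes N :: "int poly poly poly"
  assumes A: "infinite A" and B: "infinite B"
    and zero: "\<And>x y z. x \<in> A \<Longrightarrow> y \<in> B \<Longrightarrow> z \<in> primitive_roots_unity n \<Longrightarrow>
                 eval_poly (eval_xy x y) N z = 0"
    and n: "n > 0"
  shows "map_poly of_int (cyclotomic_poly n) dvd N"
proof -
  define P :: "int poly poly poly" where "P = map_poly of_int (cyclotomic_poly n)"
  have lc: "lead_coeff P = 1"
    unfolding P_def by (rule lead_coeff_map_cyclotomic)
  hence "P \<noteq> 0"
    by auto
  obtain S R where SR: "pseudo_divmod N P = (S, R)"
    by force
  \<comment> \<open>As the divisor is monic, pseudo-division is ordinary division with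
    remainder.\<close>
  from pseudo_divmod[OF \<open>P \<noteq> 0\<close> SR] lc
  have 1: "N = P * S + R" and 2: "R = 0 \<or> degree R < degree P"
    by auto
  have "R = 0"
  proof (rule ccontr)
    assume "R \<noteq> 0"
    with 2 have deg: "degree R < card (primitive_roots_unity n)"
      unfolding P_def degree_cyclotomic by simp
    have "eval_xy x y (coeff R i) = 0" if xy: "x \<in> A" "y \<in> B" for x y i
    proof -
      interpret comm_ring_hom "eval_xy x y" by (rule comm_ring_hom_eval_xy)
      interpret map: map_poly_comm_ring_hom "eval_xy x y" ..
      have "map_poly (eval_xy x y) R = 0"
      proof (rule poly_eqI_degree)
        fix z assume z: "z \<in> primitive_roots_unity n"
        have "poly (map_poly (eval_xy x y) P) z = 0"
          using z finite_primitive_roots_unity[OF n]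
          unfolding P_def map_poly_eval_xy_cyclotomic by (auto simp: poly_prod prod_zero_iff)
        thus "poly (map_poly (eval_xy x y) R) z = poly 0 z"
          using zero[OF xy z] by (simp add: 1 eval_poly_def map.hom_add map.hom_mult)
      next
        show "degree (map_poly (eval_xy x y) R) < card (primitive_roots_unity n)"
          using deg degree_map_poly_le[of "eval_xy x y" R] by linarith
        show "degree (0 :: complex poly) < card (primitive_roots_unity n)"
          using deg by simp
      qed
      thus ?thesis
        by (metis coeff_map_poly_hom coeff_0)
    qed
    hence "coeff R i = 0" for i
      by (rule eval_xy_eq_0_imp_eq_0[OF A B])
    with \<open>R \<noteq> 0\<close> show False
      by (simp add: poly_eq_iff)
  qed
  thus ?thesis
    using 1 by (simp add: P_def)
qed

text \<open>
  The leading coefficient of a common divisor is a unit, so specialising \<open>x\<close> and \<open>y\<close>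
  preserves its degree.
\<close>
lemma coprime_cyclotomicI:
  fixes D :: "int poly poly poly"
  assumes "map_poly (eval_xy x y) D = 1"
  shows "coprime D (map_poly of_int (cyclotomic_poly n))"
proof (rule coprimeI)
  fix E assume E: "E dvd D" "E dvd map_poly of_int (cyclotomic_poly n)"
  interpret comm_ring_hom "eval_xy x y" by (rule comm_ring_hom_eval_xy)
  interpret map: map_poly_comm_ring_hom "eval_xy x y" ..
  from E(2) obtain E' where "map_poly of_int (cyclotomic_poly n) = E * E'" ..
  with lead_coeff_map_cyclotomic[of n, where ?'a = "int poly poly"]
  have "lead_coeff E * lead_coeff E' = 1"
    by (simp add: lead_coeff_mult)
  hence unit: "lead_coeff E dvd 1"
    by (metis dvd_triv_left)
  hence "eval_xy x y (lead_coeff E) dvd 1"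
    by (rule hom_dvd_1)
  hence "eval_xy x y (lead_coeff E) \<noteq> 0"
    by auto
  moreover have "E \<noteq> 0"
    using unit by auto
  ultimately have "degree (map_poly (eval_xy x y) E) = degree E"
    by (intro degree_map_poly) simp
  moreover have "map_poly (eval_xy x y) E dvd 1"
    using map.hom_dvd[OF E(1)] assms by simp
  ultimately have "degree E = 0"
    by (simp add: poly_dvd_1)
  then obtain e where "E = [:e:]"
    by (rule degree_eq_zeroE)
  with unit show "is_unit E"
    by (simp add: is_unit_const_poly_iff)
qed

section \<open>The congruence in the field of rational functions\<close>

theorem theorem1p4:
  fixes d n :: nat
  assumes "d > 0" and "odd n"
  shows "ratfun_cong
    (\<Sum>k=0..n-1. qpoch var_x (var_q ^ d) k * qpoch var_y (var_q ^ d) k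
                   / qpoch (var_x * var_y * var_q ^ d) (var_q ^ (2 * d)) k * var_q ^ (d * k))
    (\<Sum>k=0..n-1. qpoch var_x (var_q ^ (2 * d)) k * qpoch var_y (var_q ^ (2 * d)) k
                   / qpoch (var_x * var_y * var_q ^ d) (var_q ^ (2 * d)) k * var_q ^ (2 * d * k))
    (map_poly of_int (cyclotomic_poly n))"
proof -
  have "n > 0"
    using assms(2) by (auto intro: Nat.gr0I)
  \<comment> \<open>Positivity of \<open>n\<close> keeps the natural subtraction
    \<open>n - 1\<close> from truncating.\<close>
  hence range: "{0..n-1} = {..<n}"
    by auto
  define X Y Q :: "int poly poly poly" where "X = [:[:[:0, 1:]:]:]" and "Y = [:[:0, 1:]:]"
    and "Q = [:0, 1:] ^ d"
  have fract: "var_x = to_fract X" "var_y = to_fract Y" "var_q ^ d = to_fract Q"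
    unfolding X_def Y_def Q_def to_fract_hom.hom_power
    by (simp_all add: var_x_def var_y_def var_q_def to_fract_def)
  have fract2: "var_q ^ (2 * d) = (to_fract Q)\<^sup>2"
    by (simp add: mult.commute power_mult fract)
  define D where "D = qpoch (X * Y * Q) (Q\<^sup>2) n"
  define N where "N = qsum_num Q Q X Y n - qsum_num (Q\<^sup>2) Q X Y n"
  have eval: "eval_poly (eval_xy x y) X z = x" "eval_poly (eval_xy x y) Y z = y"
    "eval_poly (eval_xy x y) Q z = z ^ d" for x y z
  proof -
    interpret comm_ring_hom "\<lambda>p. eval_poly (eval_xy x y) p z"
      by (intro comm_ring_hom_eval_poly comm_ring_hom_eval_xy)
    have [simp]: "eval_xy x y 0 = 0" "eval_xy x y 1 = 1"
      using eval_xy_of_int[of x y 0] eval_xy_of_int[of x y 1] by simp_all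
    show "eval_poly (eval_xy x y) X z = x" "eval_poly (eval_xy x y) Y z = y"
      by (simp_all add: X_def Y_def eval_poly_def map_poly_pCons eval_xy_def)
    show "eval_poly (eval_xy x y) Q z = z ^ d"
      unfolding Q_def hom_power by (simp add: eval_poly_def map_poly_pCons)
  qed
  \<comment> \<open>At \<open>x = 0\<close> every factor of \<open>D\<close> becomes 1. This one
    specialisation yields both \<open>D \<noteq> 0\<close> and the coprimality of the
    denominator.\<close>
  have D1: "map_poly (eval_xy 0 0) D = 1"
  proof -
    interpret comm_ring_hom "eval_xy 0 0" by (rule comm_ring_hom_eval_xy)
    interpret map: map_poly_comm_ring_hom "eval_xy 0 0" ..
    have "map_poly (eval_xy 0 0) X = 0"
      by (simp add: X_def eval_xy_def eval_poly_def map_poly_pCons)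
    thus ?thesis
      by (simp add: D_def map.hom_qpoch map.hom_mult) (simp add: qpoch_def)
  qed
  hence "D \<noteq> 0"
    by auto
  have "qsum (to_fract b) (to_fract Q) (to_fract X) (to_fract Y) n =
          to_fract (qsum_num b Q X Y n) / to_fract D" for b
  proof -
    have "to_fract D = qpoch (to_fract X * to_fract Y * to_fract Q) ((to_fract Q)\<^sup>2) n"
      by (simp add: D_def to_fract_hom.hom_qpoch to_fract_hom.hom_power)
    moreover have "to_fract D \<noteq> 0"
      using \<open>D \<noteq> 0\<close> by simp
    ultimately show ?thesis
      using qsum_num_eq[of "to_fract X" "to_fract Y" "to_fract Q" n "to_fract b"]
      by (simp add: to_fract_hom.hom_qsum_num)
  qed
  from this[of Q] this[of "Q\<^sup>2"]
  have diff: "qsum (to_fract Q) (to_fract Q) (to_fract X) (to_fract Y) n -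
        qsum ((to_fract Q)\<^sup>2) (to_fract Q) (to_fract X) (to_fract Y) n = Fract N D"
    by (simp add: Fract_conv_to_fract N_def diff_divide_distrib to_fract_hom.hom_power)
  have "map_poly of_int (cyclotomic_poly n) dvd N"
  proof (rule cyclotomic_dvdI[OF _ _ _ \<open>n > 0\<close>])
    \<comment> \<open>The real intervals are infinite and lie within the bounds of
      \<open>qsum_square_base\<close>.\<close>
    show "infinite (complex_of_real ` {0<..<1/8})" "infinite (complex_of_real ` {1<..<2})"
      by (simp_all add: finite_image_iff inj_on_def)
    fix x y z :: complex
    assume x: "x \<in> complex_of_real ` {0<..<1/8}" and y: "y \<in> complex_of_real ` {1<..<2}"
      and z: "z \<in> primitive_roots_unity n"
    interpret comm_ring_hom "\<lambda>p. eval_poly (eval_xy x y) p z"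
      by (intro comm_ring_hom_eval_poly comm_ring_hom_eval_xy)
    \<comment> \<open>\<open>q\<close> may fail to be a primitive \<open>n\<close>-th root of unity,
      but \<open>q ^ n = 1\<close> suffices for \<open>qsum_square_base\<close>.\<close>
    define q where "q = z ^ d"
    have q: "q ^ n = 1"
    proof -
      have "q ^ n = (z ^ n) ^ d"
        unfolding q_def power_mult [symmetric] by (simp only: mult.commute)
      thus ?thesis
        using z by (simp add: primitive_roots_unity_def)
    qed
    have xy: "norm x \<le> 1 / 8" "1 \<le> norm y" "norm y \<le> 2"
      using x y by auto
    have "norm q = 1"
      using power_eq_1_iff[OF q] \<open>n > 0\<close> by simp
    have small: "norm (x * y * q * (q\<^sup>2) ^ i) \<le> 1 / 4" for i
      using mult_mono[OF xy(1,3)] \<open>norm q = 1\<close> by (simp add: norm_mult norm_power)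
    have "x * y * q * (q\<^sup>2) ^ i \<noteq> 1" for i
    proof
      assume "x * y * q * (q\<^sup>2) ^ i = 1"
      with small[of i] show False
        by simp
    qed
    hence "qpoch (x * y * q) (q\<^sup>2) n \<noteq> 0"
      by (simp add: qpoch_eq_0_iff)
    hence "qsum_num q q x y n - qsum_num (q\<^sup>2) q x y n = 0"
      using qsum_square_base[OF q assms(2) xy] by (simp add: qsum_num_eq)
    thus "eval_poly (eval_xy x y) N z = 0"
      unfolding N_def hom_minus hom_qsum_num hom_power eval q_def .
  qed
  moreover have "coprime D (map_poly of_int (cyclotomic_poly n))"
    using D1 by (rule coprime_cyclotomicI)
  moreover have "(\<Sum>k=0..n-1. qpoch var_x (var_q ^ d) k * qpoch var_y (var_q ^ d) k
                   / qpoch (var_x * var_y * var_q ^ d) (var_q ^ (2 * d)) k * var_q ^ (d * k)) =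
        qsum (to_fract Q) (to_fract Q) (to_fract X) (to_fract Y) n"
    unfolding qsum_def range power_mult[of var_q d] fract2 fract ..
  moreover have "(\<Sum>k=0..n-1. qpoch var_x (var_q ^ (2 * d)) k * qpoch var_y (var_q ^ (2 * d)) k
                   / qpoch (var_x * var_y * var_q ^ d) (var_q ^ (2 * d)) k * var_q ^ (2 * d * k)) =
        qsum ((to_fract Q)\<^sup>2) (to_fract Q) (to_fract X) (to_fract Y) n"
    unfolding qsum_def range power_mult[of var_q "2 * d"] fract2 fract ..
  ultimately show ?thesis
    unfolding ratfun_cong_def using diff \<open>D \<noteq> 0\<close> by (metis (no_types))
qed

end
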